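(* Let $n,c\ge 2$ and $1\le s\le c-1$ be fixed integers, let $t=\lceil sn/c\rceil$ and let $\lambda\in[c]$ satisfy $\lambda\equiv sn\pmod c$. Then \[f^q_{c,s}(n)\ge(1-o(1))\frac{\binom{n}{t}}{\binom{n}{t}-m(n,t,\lambda;s+1,c-s+1)}\,q^t,\] where $o(1)\to0$ as $q\to\infty$.
   Context: $[m]=\{1,\dots,m\}$. A code $\mathcal{C}\subseteq[q]^n$ is $(c,s)$-frameproof if for every $c+1$ codewords $\bm x^0,\dots,\bm x^c\in\mathcal{C}$ with $\bm x^0\neq\bm x^j$ for each $j\in[c]$ ($\bm x^1,\dots,\bm x^c$ not necessarily distinct), there is a coordinate $i\in[n]$ with $|\{j\in[c]:x^j_i=x^0_i\}|<s$. $f^q_{c,s}(n)$ is the maximum size of a $(c,s)$-frameproof code in $[q]^n$. A sequence $A_1,\dots,A_\lambda$ of subsets of $[n]$ (repetitions allowed) is $(k_1,k_2)$-disjoint if $\bigcap_{i\in B}A_i=\emptyset$ for every $k_1$-subset $B\subseteq[\lambda]$ and $\bigcup_{i\in B}A_i=[n]$ for every $k_2$-subset $B\subseteq[\lambda]$ (each condition vacuous if the subset size exceeds $\lambda$). $m(n,t,\lambda;k_1,k_2)$ is the maximum size of a family of $t$-subsets of $[n]$ containing no $A_1,\dots,A_\lambda$ (not necessarily distinct members) forming a $(k_1,k_2)$-disjoint sequence. *)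

theory Defs
  imports Complex_Main "HOL-Library.FuncSet" "HOL-Number_Theory.Cong"
begin

text \<open>Words of \<open>[q]\<^sup>n\<close> are extensional functions (so that equality of words is
  equality of functions), with coordinates and symbols counted from 1.\<close>

definition words :: "nat \<Rightarrow> nat \<Rightarrow> (nat \<Rightarrow> nat) set" where
  "words q n = {1..n} \<rightarrow>\<^sub>E {1..q}"

definition frameproof :: "nat \<Rightarrow> nat \<Rightarrow> nat \<Rightarrow> (nat \<Rightarrow> nat) set \<Rightarrow> bool" where
  "frameproof c s n C \<longleftrightarrow>
     (\<forall>x :: nat \<Rightarrow> nat \<Rightarrow> nat.
        (\<forall>j\<in>{0..c}. x j \<in> C) \<longrightarrow> (\<forall>j\<in>{1..c}. x 0 \<noteq> x j) \<longrightarrow>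
        (\<exists>i\<in>{1..n}. card {j\<in>{1..c}. x j i = x 0 i} < s))"

definition max_frameproof :: "nat \<Rightarrow> nat \<Rightarrow> nat \<Rightarrow> nat \<Rightarrow> nat" where
  "max_frameproof q c s n = Max {card C | C. C \<subseteq> words q n \<and> frameproof c s n C}"

text \<open>The sequence is the restriction of \<open>A\<close> to \<open>{1..l}\<close>. For \<open>k1 = 0\<close> the empty
  intersection would be \<open>UNIV\<close> rather than \<open>{1..n}\<close>; only positive \<open>k1\<close> is used.\<close>

definition disjoint_seq :: "nat \<Rightarrow> nat \<Rightarrow> nat \<Rightarrow> nat \<Rightarrow> (nat \<Rightarrow> nat set) \<Rightarrow> bool" where
  "disjoint_seq n l k1 k2 A \<longleftrightarrow>
     (\<forall>B. B \<subseteq> {1..l} \<and> card B = k1 \<longrightarrow> (\<Inter>i\<in>B. A i) = {}) \<and>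
     (\<forall>B. B \<subseteq> {1..l} \<and> card B = k2 \<longrightarrow> (\<Union>i\<in>B. A i) = {1..n})"

definition disjoint_seq_free :: "nat \<Rightarrow> nat \<Rightarrow> nat \<Rightarrow> nat \<Rightarrow> nat set set \<Rightarrow> bool" where
  "disjoint_seq_free n l k1 k2 F \<longleftrightarrow>
     \<not> (\<exists>A. (\<forall>i\<in>{1..l}. A i \<in> F) \<and> disjoint_seq n l k1 k2 A)"

definition max_disjoint_seq_free :: "nat \<Rightarrow> nat \<Rightarrow> nat \<Rightarrow> nat \<Rightarrow> nat \<Rightarrow> nat" where
  "max_disjoint_seq_free n t l k1 k2 =
     Max {card F | F. F \<subseteq> {T. T \<subseteq> {1..n} \<and> card T = t} \<and> disjoint_seq_free n l k1 k2 F}"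

text \<open>Both maxima range over finite nonempty sets.\<close>

lemma max_frameproof_wf:
  "finite {card C | C. C \<subseteq> words q n \<and> frameproof c s n C}"
  "{card C | C. C \<subseteq> words q n \<and> frameproof c s n C} \<noteq> {}"
proof -
  have "finite (words q n)" by (simp add: words_def finite_PiE)
  then have "finite {C. C \<subseteq> words q n \<and> frameproof c s n C}"
    by (auto intro: finite_subset[of _ "Pow (words q n)"])
  then show "finite {card C | C. C \<subseteq> words q n \<and> frameproof c s n C}"
    by (simp add: setcompr_eq_image)
  have "frameproof c s n {}" by (auto simp: frameproof_def)
  then show "{card C | C. C \<subseteq> words q n \<and> frameproof c s n C} \<noteq> {}" by blast
qed

lemma max_disjoint_seq_free_wf:
  "finite {card F | F. F \<subseteq> {T. T \<subseteq> {1..n} \<and> card T = t} \<and> disjoint_seq_free n l k1 k2 F}"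
  "1 \<le> l \<Longrightarrow>
   {card F | F. F \<subseteq> {T. T \<subseteq> {1..n} \<and> card T = t} \<and> disjoint_seq_free n l k1 k2 F} \<noteq> {}"
proof -
  let ?X = "{T. T \<subseteq> {1..n} \<and> card T = t}"
  have "finite ?X" by (auto intro: finite_subset[of _ "Pow {1..n}"])
  then have "finite {F. F \<subseteq> ?X \<and> disjoint_seq_free n l k1 k2 F}"
    by (auto intro: finite_subset[of _ "Pow ?X"])
  then show "finite {card F | F. F \<subseteq> ?X \<and> disjoint_seq_free n l k1 k2 F}"
    by (simp add: setcompr_eq_image)
  assume "1 \<le> l"
  then have "disjoint_seq_free n l k1 k2 {}" by (auto simp: disjoint_seq_free_def)
  then show "{card F | F. F \<subseteq> ?X \<and> disjoint_seq_free n l k1 k2 F} \<noteq> {}" by blast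
qed

end

theory Submission
  imports Defs "HOL-Computational_Algebra.Polynomial"
begin

text \<open>
  If \<open>c\<close> words together agree with a word \<open>x\<close> at least \<open>s\<close> times in every coordinate, while each
  agrees with \<open>x\<close> in at most \<open>t\<close> coordinates, then discarding \<open>c - l\<close> of the agreement sets leaves
  an \<open>(s+1, c-s+1)\<close>-disjoint sequence of \<open>t\<close>-sets. So it suffices that distinct codewords agree in
  at most \<open>t\<close> coordinates and that the agreement sets of size \<open>t\<close> with a given codeword lie in
  a family without such sequences.

  Assign to each message \<open>x\<close> an arbitrary label in \<open>\<int>/p\<close> for each \<open>t\<close>-set \<open>T\<close>. A sum of Reed-Solomon
  codes with varying evaluation points, cut down by one linear equation, gives for each message
  \<open>Q\<^sup>t/p\<close> words over an alphabet of size \<open>Q\<close> such that words of different messages agree on \<open>T\<close>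
  only if the \<open>T\<close>-labels coincide, and distinct words of the same message agree on no \<open>T\<close>. Only
  finitely many small differences must be invertible mod \<open>p\<close>, so \<open>p\<close> need not be prime. The messages
  are pairs of an extremal family \<open>F\<close> and a vector \<open>u\<close> in \<open>[K]\<^sup>F\<close> (times a level), with \<open>T\<close>-label
  \<open>(F, u restricted to F - {T})\<close>. As the extremal families are permuted by the symmetric group, each
  \<open>T\<close> lies in the same proportion of them, and counting labels gives the constant
  as \<open>K\<close> and then \<open>p\<close> tend to infinity.
\<close>

section \<open>Agreement sets\<close>

text \<open>Double counting: the deficits \<open>t - card (B j)\<close> and the surpluses of
  coverage over \<open>s\<close> sum to \<open>c * t - s * n = c - l\<close>. So discarding at most
  \<open>c - l\<close> indices removes all sets smaller than \<open>t\<close> and lowers every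
  coverage to at most \<open>s\<close>. Each coordinate is missed by at most \<open>c - s\<close> of
  the original sets, whence any \<open>c - s + 1\<close> of them cover.\<close>

lemma agreement_subsequence:
  fixes B :: "nat \<Rightarrow> nat set"
  assumes sub: "\<And>j. j \<in> {1..c} \<Longrightarrow> B j \<subseteq> {1..n}"
    and small: "\<And>j. j \<in> {1..c} \<Longrightarrow> card (B j) \<le> t"
    and cover: "\<And>i. i \<in> {1..n} \<Longrightarrow> s \<le> card {j\<in>{1..c}. i \<in> B j}"
    and eq: "c * t + l = s * n + c" and "l \<le> c" and "s \<le> c"
  obtains A where "\<And>k. k \<in> {1..l} \<Longrightarrow> \<exists>j\<in>{1..c}. A k = B j \<and> card (B j) = t"
    and "disjoint_seq n l (s + 1) (c - s + 1) A"
proof -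
  define cov where "cov i = card {j\<in>{1..c}. i \<in> B j}" for i
  have sum_eq: "(\<Sum>j\<in>{1..c}. card (B j)) = (\<Sum>i\<in>{1..n}. cov i)"
  proof -
    have "(\<Sum>j\<in>{1..c}. card (B j)) = (\<Sum>j\<in>{1..c}. card {i\<in>{1..n}. i \<in> B j})"
    proof (rule sum.cong[OF refl])
      fix j assume "j \<in> {1..c}"
      then have "B j = {i\<in>{1..n}. i \<in> B j}" using sub by blast
      then show "card (B j) = card {i\<in>{1..n}. i \<in> B j}" by (rule arg_cong)
    qed
    also have "\<dots> = (\<Sum>i\<in>{1..n}. cov i)"
      unfolding cov_def by (rule sum_multicount_gen) auto
    finally show ?thesis .
  qed
  \<comment> \<open>\<open>D i\<close> is the surplus at \<open>i\<close>: dropping it leaves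
    \<open>s\<close> of the sets through a coordinate in \<open>{1..n}\<close>.\<close>
  have "\<exists>D. D \<subseteq> {j\<in>{1..c}. i \<in> B j} \<and> card D = cov i - s" for i
    unfolding cov_def by (meson diff_le_self obtain_subset_with_card_n)
  then obtain D where D: "\<And>i. D i \<subseteq> {j\<in>{1..c}. i \<in> B j}" "\<And>i. card (D i) = cov i - s"
    by metis
  define E where "E = {j\<in>{1..c}. card (B j) < t} \<union> (\<Union>i\<in>{1..n}. D i)"
  have E_sub: "E \<subseteq> {1..c}" using D(1) unfolding E_def by blast
  have c1: "card {j\<in>{1..c}. card (B j) < t} \<le> (\<Sum>j\<in>{1..c}. t - card (B j))"
  proof -
    have "card {j\<in>{1..c}. card (B j) < t} = (\<Sum>j\<in>{1..c}. if card (B j) < t then 1 else 0)"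
      by (simp add: sum.If_cases Int_def)
    also have "\<dots> \<le> (\<Sum>j\<in>{1..c}. t - card (B j))"
      by (rule sum_mono) auto
    finally show ?thesis .
  qed
  have c2: "card (\<Union>i\<in>{1..n}. D i) \<le> (\<Sum>i\<in>{1..n}. cov i - s)"
    using card_UN_le[of "{1..n}" D] D(2) by simp
  have s1: "(\<Sum>j\<in>{1..c}. t - card (B j)) + (\<Sum>j\<in>{1..c}. card (B j)) = c * t"
    using small by (simp add: sum.distrib[symmetric])
  have s2: "(\<Sum>i\<in>{1..n}. cov i - s) + s * n = (\<Sum>i\<in>{1..n}. cov i)"
  proof -
    have "(\<Sum>i\<in>{1..n}. cov i - s) + (\<Sum>i\<in>{1..n}. s) = (\<Sum>i\<in>{1..n}. cov i)"
      using cover by (simp add: sum.distrib[symmetric] cov_def del: sum_constant)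
    then show ?thesis by (simp add: mult.commute)
  qed
  have "card E \<le> c - l"
    using card_Un_le[of "{j\<in>{1..c}. card (B j) < t}" "\<Union>i\<in>{1..n}. D i"] c1 c2 s1 s2 sum_eq eq
    unfolding E_def by linarith
  then have "l \<le> card ({1..c} - E)"
    using E_sub \<open>l \<le> c\<close> by (subst card_Diff_subset) (auto intro: finite_subset)
  then obtain J where J: "J \<subseteq> {1..c} - E" "card J = l" "finite J"
    by (meson obtain_subset_with_card_n)
  obtain g where g: "bij_betw g {1..l} J"
    using ex_bij_betw_nat_finite_1[OF J(3)] J(2) by auto
  define A where "A k = B (g k)" for k
  have gJ: "g k \<in> J" if "k \<in> {1..l}" for k
    using g that by (auto simp: bij_betw_def)
  have inj: "inj_on g X" if "X \<subseteq> {1..l}" for X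
    using g that by (meson bij_betw_def inj_on_subset)
  have "(\<Inter>k\<in>X. A k) = {}" if X: "X \<subseteq> {1..l}" "card X = s + 1" for X
  proof (rule ccontr)
    assume "(\<Inter>k\<in>X. A k) \<noteq> {}"
    then obtain z where z: "\<And>k. k \<in> X \<Longrightarrow> z \<in> B (g k)" by (auto simp: A_def)
    obtain k0 where "k0 \<in> X" using X by fastforce
    then have zn: "z \<in> {1..n}"
      using z sub gJ J(1) X(1) by blast
    have "g ` X \<subseteq> {j\<in>{1..c}. z \<in> B j} - D z"
    proof (rule image_subsetI)
      fix k assume "k \<in> X"
      then have "g k \<in> {1..c} - E" using gJ J(1) X(1) by blast
      then show "g k \<in> {j\<in>{1..c}. z \<in> B j} - D z"
        using z[OF \<open>k \<in> X\<close>] zn unfolding E_def by blast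
    qed
    then have "card (g ` X) \<le> card ({j\<in>{1..c}. z \<in> B j} - D z)"
      by (intro card_mono) auto
    also have "\<dots> = cov z - (cov z - s)"
      using D by (subst card_Diff_subset) (auto simp: cov_def intro: finite_subset[OF D(1)])
    also have "\<dots> \<le> s" by simp
    finally show False using X inj[OF X(1)] by (simp add: card_image)
  qed
  moreover have "(\<Union>k\<in>X. A k) = {1..n}" if X: "X \<subseteq> {1..l}" "card X = c - s + 1" for X
  proof
    have gX: "g ` X \<subseteq> {1..c}" using gJ J(1) X(1) by blast
    show "(\<Union>k\<in>X. A k) \<subseteq> {1..n}"
      using sub gJ J(1) X(1) unfolding A_def by blast
    show "{1..n} \<subseteq> (\<Union>k\<in>X. A k)"
    proof (rule ccontr)
      assume "\<not> ?thesis"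
      then obtain i where i: "i \<in> {1..n}" "\<And>k. k \<in> X \<Longrightarrow> i \<notin> B (g k)"
        unfolding A_def by blast
      have "{j\<in>{1..c}. i \<in> B j} \<subseteq> {1..c} - g ` X"
        using i by auto
      then have "cov i \<le> card ({1..c} - g ` X)"
        unfolding cov_def by (intro card_mono) auto
      also have "\<dots> = c - (c - s + 1)"
        using X inj[OF X(1)] gX by (subst card_Diff_subset) (auto simp: card_image intro: finite_subset)
      \<comment> \<open>With truncated subtraction this would fail at \<open>s = 0\<close>; the
        image of \<open>X\<close> under \<open>g\<close> has \<open>c - s + 1\<close> elements and
        lies in \<open>{1..c}\<close>, which excludes that case.\<close>
      also have "\<dots> < s"
      proof -
        have "c - s + 1 \<le> c"
          using card_mono[OF _ gX] X(2) inj[OF X(1)] by (simp add: card_image)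
        then show ?thesis using \<open>s \<le> c\<close> by simp
      qed
      finally show False using cover[OF i(1)] by (simp add: cov_def)
    qed
  qed
  moreover have "\<exists>j\<in>{1..c}. A k = B j \<and> card (B j) = t" if "k \<in> {1..l}" for k
  proof -
    have "g k \<in> {1..c}" "\<not> card (B (g k)) < t"
      using gJ[OF that] J(1) unfolding E_def by blast+
    then show ?thesis
      using small[of "g k"] unfolding A_def by (intro bexI[of _ "g k"]) auto
  qed
  ultimately show ?thesis
    by (intro that[of A]) (auto simp: disjoint_seq_def)
qed

text \<open>Agreement sets with \<open>x 0\<close> that violate the condition would yield a
  forbidden sequence inside \<open>F\<close>, by \<open>agreement_subsequence\<close>. As
  \<open>F\<close> may depend on the codeword, each message can later carry its own extremal
  family.\<close>

lemma frameproof_if_agreements: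
  assumes eq: "c * t + l = s * n + c" and "l \<le> c" and "s \<le> c"
    and agr: "\<And>x. x \<in> C \<Longrightarrow> \<exists>F. disjoint_seq_free n l (s + 1) (c - s + 1) F \<and>
      (\<forall>y\<in>C. y \<noteq> x \<longrightarrow> card {i\<in>{1..n}. y i = x i} \<le> t \<and>
         (card {i\<in>{1..n}. y i = x i} = t \<longrightarrow> {i\<in>{1..n}. y i = x i} \<in> F))"
  shows "frameproof c s n C"
  unfolding frameproof_def
proof (intro allI impI, rule ccontr)
  fix x :: "nat \<Rightarrow> nat \<Rightarrow> nat"
  assume C: "\<forall>j\<in>{0..c}. x j \<in> C" and ne: "\<forall>j\<in>{1..c}. x 0 \<noteq> x j"
    and "\<not> (\<exists>i\<in>{1..n}. card {j\<in>{1..c}. x j i = x 0 i} < s)"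
  then have cov: "\<And>i. i \<in> {1..n} \<Longrightarrow> s \<le> card {j\<in>{1..c}. x j i = x 0 i}"
    by (meson not_less)
  define B where "B j = {i\<in>{1..n}. x j i = x 0 i}" for j
  obtain F where F: "disjoint_seq_free n l (s + 1) (c - s + 1) F"
    "\<And>y. y \<in> C \<Longrightarrow> y \<noteq> x 0 \<Longrightarrow> card {i\<in>{1..n}. y i = x 0 i} \<le> t \<and>
         (card {i\<in>{1..n}. y i = x 0 i} = t \<longrightarrow> {i\<in>{1..n}. y i = x 0 i} \<in> F)"
    using agr[of "x 0"] C by auto
  have B: "card (B j) \<le> t \<and> (card (B j) = t \<longrightarrow> B j \<in> F)" if "j \<in> {1..c}" for j
  proof -
    have "x j \<in> C" "x j \<noteq> x 0" using C ne that by (auto dest: bspec[of _ _ j])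
    then show ?thesis using F(2) unfolding B_def by blast
  qed
  obtain A where A: "\<And>k. k \<in> {1..l} \<Longrightarrow> \<exists>j\<in>{1..c}. A k = B j \<and> card (B j) = t"
    "disjoint_seq n l (s + 1) (c - s + 1) A"
  proof (rule agreement_subsequence[of c B n t s l])
    show "s \<le> card {j\<in>{1..c}. i \<in> B j}" if "i \<in> {1..n}" for i
      using cov[OF that] that by (simp add: B_def)
  qed (use B eq assms(2,3) in \<open>auto simp: B_def\<close>)
  have "\<forall>k\<in>{1..l}. A k \<in> F" using A(1) B by metis
  with A(2) F(1) show False by (auto simp: disjoint_seq_free_def)
qed

section \<open>Codes with prescribed labels\<close>

text \<open>The bound on the number of roots survives a composite modulus when differences of roots
  are units: after division by \<open>[:-x, 1:]\<close> the factor \<open>y - x\<close> cancels, so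
  the quotient still vanishes at the other points.\<close>

lemma dvd_coeff_if_roots:
  fixes f :: "int poly"
  assumes "finite X"
    and "\<And>x y. x \<in> X \<Longrightarrow> y \<in> X \<Longrightarrow> x \<noteq> y \<Longrightarrow> coprime p (x - y)"
    and "\<And>x. x \<in> X \<Longrightarrow> p dvd poly f x"
    and "f = 0 \<or> degree f < card X"
  shows "p dvd coeff f j"
  using assms
proof (induction X arbitrary: f j rule: finite_induct)
  case (insert x X)
  define g where "g = synthetic_div f x"
  have f: "f = [:-x, 1:] * g + [:poly f x:]"
    using synthetic_div_correct'[of x f] by (simp add: g_def)
  have "p dvd poly g y" if "y \<in> X" for y
  proof -
    have "poly f y = (y - x) * poly g y + poly f x"
      by (subst f) (simp add: algebra_simps)
    then have "p dvd (y - x) * poly g y"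
      using insert.prems(2)[of y] insert.prems(2)[of x] that
      by (metis add_diff_cancel_right' dvd_diff insertCI)
    moreover have "coprime p (y - x)" using insert that by fastforce
    ultimately show ?thesis by (simp add: coprime_dvd_mult_right_iff)
  qed
  moreover have "g = 0 \<or> degree g < card X"
    using insert.prems(3) insert.hyps
    by (auto simp: g_def degree_synthetic_div synthetic_div_eq_0_iff)
  ultimately have g: "p dvd coeff g i" for i
    using insert.IH[of g i] insert.prems(1) by blast
  have "coeff f j = coeff ([:-x, 1:] * g) j + coeff [:poly f x:] j"
    using f by (metis coeff_add)
  moreover have "p dvd coeff [:poly f x:] j"
    using insert.prems(2)[of x] by (auto simp: coeff_pCons split: nat.splits)
  moreover have "p dvd coeff ([:-x, 1:] * g) j"
    using g by (auto simp: coeff_pCons intro!: dvd_diff dvd_add split: nat.splits)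
  ultimately show ?case by (metis dvd_add)
qed auto

text \<open>Summing \<open>f\<close> over the two choices \<open>a k\<close>, \<open>b k\<close> with alternating signs takes a
  mixed finite difference, which kills every product not involving all of \<open>R\<close>.\<close>

lemma alternating_sum_prod:
  fixes a b :: "'a \<Rightarrow> int"
  assumes "finite R" and "finite X"
  shows "(\<Sum>U\<in>Pow R. (-1) ^ card U * (\<Prod>k\<in>X. if k \<in> U then b k else a k)) =
    (if R \<subseteq> X then (\<Prod>k\<in>R. a k - b k) * (\<Prod>k\<in>X - R. a k) else 0)"
  using assms
proof (induction R arbitrary: X rule: finite_induct)
  case empty
  then show ?case by simp
next
  case (insert r R)
  let ?P = "\<lambda>X U. (-1) ^ card U * (\<Prod>k\<in>X. if k \<in> U then b k else a k)"
  have "(\<Sum>U\<in>Pow (insert r R). ?P X U) = (\<Sum>U\<in>Pow R. ?P X U) + (\<Sum>U\<in>insert r ` Pow R. ?P X U)"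
    unfolding Pow_insert using insert.hyps by (subst sum.union_disjoint) auto
  also have "(\<Sum>U\<in>insert r ` Pow R. ?P X U) = (\<Sum>U\<in>Pow R. ?P X (insert r U))"
    using insert.hyps by (subst sum.reindex) (auto simp: inj_on_def)
  finally have *: "(\<Sum>U\<in>Pow (insert r R). ?P X U) = (\<Sum>U\<in>Pow R. ?P X U + ?P X (insert r U))"
    by (simp add: sum.distrib)
  have card: "card (insert r U) = Suc (card U)" if "U \<in> Pow R" for U
    using that insert.hyps by (subst card_insert_disjoint) (auto intro: finite_subset)
  show ?case
  proof (cases "r \<in> X")
    case False
    have "?P X U + ?P X (insert r U) = 0" if "U \<in> Pow R" for U
    proof -
      have "(\<Prod>k\<in>X. if k \<in> insert r U then b k else a k) = (\<Prod>k\<in>X. if k \<in> U then b k else a k)"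
        using False by (intro prod.cong) auto
      then show ?thesis using card[OF that] by simp
    qed
    then show ?thesis using * False by simp
  next
    case True
    have "?P X U + ?P X (insert r U) = (a r - b r) * ?P (X - {r}) U" if "U \<in> Pow R" for U
    proof -
      have "r \<notin> U" using that insert.hyps by auto
      have "(\<Prod>k\<in>X - {r}. if k \<in> insert r U then b k else a k) =
          (\<Prod>k\<in>X - {r}. if k \<in> U then b k else a k)"
        by (intro prod.cong) auto
      moreover have "(\<Prod>k\<in>X. h k) = h r * (\<Prod>k\<in>X - {r}. h k)" for h :: "'a \<Rightarrow> int"
        using True insert.prems by (simp add: prod.remove)
      ultimately show ?thesis
        using \<open>r \<notin> U\<close> card[OF that] by (simp add: algebra_simps)
    qed
    then have "(\<Sum>U\<in>Pow (insert r R). ?P X U) = (a r - b r) * (\<Sum>U\<in>Pow R. ?P (X - {r}) U)"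
      using * by (simp add: sum_distrib_left)
    also have "\<dots> = (a r - b r) *
        (if R \<subseteq> X - {r} then (\<Prod>k\<in>R. a k - b k) * (\<Prod>k\<in>X - {r} - R. a k) else 0)"
      using insert.IH[of "X - {r}"] insert.prems by simp
    also have "X - {r} - R = X - insert r R" by auto
    also have "R \<subseteq> X - {r} \<longleftrightarrow> insert r R \<subseteq> X" using True insert.hyps by auto
    finally show ?thesis using insert.hyps by (simp add: mult.assoc)
  qed
qed

section \<open>Reed-Solomon components carrying labels\<close>

definition tsets :: "nat \<Rightarrow> nat \<Rightarrow> nat set set" where
  "tsets n t = {T. T \<subseteq> {1..n} \<and> card T = t}"

lemma finite_tsets [simp]: "finite (tsets n t)"
  by (auto simp: tsets_def intro: finite_subset[of _ "Pow {1..n}"])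

lemma finite_tset: "T \<in> tsets n t \<Longrightarrow> finite T"
  by (auto simp: tsets_def intro: finite_subset)

lemma card_tsets: "card (tsets n t) = n choose t"
  using n_subsets[of "{1..n}" t] by (simp add: tsets_def)

text \<open>A component \<open>(S, U)\<close> of the alphabet carries a Reed-Solomon code whose evaluation
  points depend on \<open>U\<close>; the coordinate \<open>Min S\<close> is the point at infinity, where the
  label of \<open>S\<close> is added with sign \<open>(-1)\<^bsup>card U\<^esup>\<close>. The words are subject to the equation that the constant
  coefficients of all components sum to 0; the alternation over \<open>U\<close> makes the sum at an
  information set \<open>T\<close> see the label of \<open>T\<close> only.\<close>

definition comps :: "nat \<Rightarrow> nat \<Rightarrow> (nat set \<times> nat set) set" where
  "comps n t = (SIGMA S:tsets n t. Pow (S - {Min S}))"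

text \<open>Points of different coordinates in \<open>{1..n}\<close> stay distinct under either
  choice and differ by less than \<open>2 * n\<close>; the two choices at one coordinate differ by
  1, so each factor of a mixed difference is 1.\<close>

definition pt :: "nat set \<times> nat set \<Rightarrow> nat \<Rightarrow> int" where
  "pt e k = (if k \<in> snd e then 2 * int k + 1 else 2 * int k)"

definition val :: "nat \<Rightarrow> (nat set \<Rightarrow> int) \<Rightarrow> (nat set \<times> nat set \<Rightarrow> int poly) \<Rightarrow>
    nat set \<times> nat set \<Rightarrow> nat \<Rightarrow> int" where
  "val t c w e k = (if k = Min (fst e) then coeff (w e) (t - 1) + (-1) ^ card (snd e) * c (fst e)
     else poly (w e) (pt e k))"

lemma finite_comps [simp]: "finite (comps n t)"
  unfolding comps_def
  by (intro finite_SigmaI) (auto simp: finite_tset)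

lemma val_diff:
  "val t (\<lambda>S. c S - c' S) (\<lambda>e. w e - w' e) e k = val t c w e k - val t c' w' e k"
  by (simp add: val_def algebra_simps)

locale evaluation_modulus =
  fixes n t :: nat and p :: int
  assumes t_pos: "1 \<le> t"
    and coprime_small: "\<And>d. 1 \<le> d \<Longrightarrow> d \<le> 2 * int n \<Longrightarrow> coprime p d"
begin

lemma coprime_pt_diff:
  assumes "k \<in> {1..n}" "k' \<in> {1..n}" "k \<noteq> k'"
  shows "coprime p (pt e k - pt e k')"
proof -
  have "pt e k - pt e k' \<noteq> 0" "\<bar>pt e k - pt e k'\<bar> \<le> 2 * int n"
    using assms by (auto simp: pt_def)
  then have "coprime p \<bar>pt e k - pt e k'\<bar>"
    by (intro coprime_small) auto
  then show ?thesis by simp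
qed

lemma inj_on_pt: "inj_on (pt e) X"
  by (auto simp: inj_on_def pt_def split: if_splits)

lemma dvd_coeff_if_vanishing:
  assumes "K \<subseteq> {1..n}" and "\<And>k. k \<in> K \<Longrightarrow> p dvd poly f (pt e k)"
    and "f = 0 \<or> degree f < card K"
  shows "p dvd coeff f j"
proof (rule dvd_coeff_if_roots[of "pt e ` K"])
  show "finite (pt e ` K)" using assms(1) by (auto intro: finite_subset)
  show "f = 0 \<or> degree f < card (pt e ` K)"
    using assms(3) by (simp add: card_image[OF inj_on_pt])
  show "coprime p (x - y)" if "x \<in> pt e ` K" "y \<in> pt e ` K" "x \<noteq> y" for x y
    using that assms(1) by (auto intro!: coprime_pt_diff)
qed (use assms in auto)

text \<open>Subtracting a multiple of the monic polynomial with roots at the \<open>t - 1\<close>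
  points leaves 0 or a degree below \<open>t - 1\<close>, and still \<open>t - 1\<close> zeros
  modulo \<open>p\<close>.\<close>

lemma cong_coeff_if_vanishing:
  assumes K: "K \<subseteq> {1..n}" "card K = t - 1" and "\<And>k. k \<in> K \<Longrightarrow> p dvd poly f (pt e k)"
    and "degree f < t"
  shows "[coeff f j = coeff f (t - 1) * coeff (\<Prod>k\<in>K. [:- pt e k, 1:]) j] (mod p)"
proof -
  let ?P = "\<Prod>k\<in>K. [:- pt e k, 1:]"
  define g where "g = f - smult (coeff f (t - 1)) ?P"
  have fin: "finite K" using K(1) by (rule finite_subset) simp
  have deg: "degree ?P = t - 1"
    by (subst degree_prod_eq_sum_degree) (auto simp: K)
  have "lead_coeff ?P = 1" by (subst lead_coeff_prod) simp
  then have "coeff g (t - 1) = 0" by (simp add: g_def deg)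
  moreover have "degree g \<le> t - 1"
    unfolding g_def using assms(4) deg by (intro degree_diff_le) (auto intro: order.trans[OF degree_smult_le])
  ultimately have "g = 0 \<or> degree g < card K"
    using K(2) by (metis le_neq_implies_less leading_coeff_0_iff)
  moreover have "poly g (pt e k) = poly f (pt e k)" if "k \<in> K" for k
    using that fin by (auto simp: g_def poly_prod intro!: prod_zero)
  ultimately have "p dvd coeff g j"
    using assms by (intro dvd_coeff_if_vanishing[of K g e]) auto
  then show ?thesis by (simp add: g_def cong_iff_dvd_diff)
qed

text \<open>The MDS property: any \<open>t\<close> coordinates form an information set. The point at
  infinity contributes the coefficient of degree \<open>t - 1\<close>, to which all others are
  proportional modulo \<open>p\<close> once the other \<open>t - 1\<close> values vanish.\<close>

lemma dvd_coeff_if_val_vanishing: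
  assumes T: "T \<in> tsets n t" and "degree (w e) < t"
    and z: "\<And>k. k \<in> T \<Longrightarrow> p dvd val t (\<lambda>_. 0) w e k"
  shows "p dvd coeff (w e) j"
proof (cases "Min (fst e) \<in> T")
  case True
  let ?K = "T - {Min (fst e)}"
  have "?K \<subseteq> {1..n}" "card ?K = t - 1"
    using T True by (auto simp: tsets_def card_Diff_singleton)
  moreover have "p dvd poly (w e) (pt e k)" if "k \<in> ?K" for k
    using z[of k] that by (simp add: val_def)
  ultimately have "[coeff (w e) j = coeff (w e) (t - 1) * coeff (\<Prod>k\<in>?K. [:- pt e k, 1:]) j] (mod p)"
    using assms(2) by (intro cong_coeff_if_vanishing)
  moreover have "p dvd coeff (w e) (t - 1)" using z[OF True] by (simp add: val_def)
  ultimately show ?thesis by (meson cong_dvd_iff dvd_mult2)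
next
  case False
  then have "p dvd poly (w e) (pt e k)" if "k \<in> T" for k
    using z[of k] that by (auto simp: val_def split: if_splits)
  then show ?thesis
    using T assms(2) by (intro dvd_coeff_if_vanishing[of T "w e" e]) (auto simp: tsets_def)
qed

text \<open>The label enters a component only at infinity. If that coordinate lies in
  \<open>T\<close>, it prescribes the coefficient of degree \<open>t - 1\<close>, and the other
  zeros then fix the polynomial; otherwise \<open>t\<close> ordinary zeros kill it modulo
  \<open>p\<close>.\<close>

lemma cong_constant_coeff:
  assumes T: "T \<in> tsets n t" and "degree (w e) < t"
    and z: "\<And>k. k \<in> T \<Longrightarrow> p dvd val t c w e k"
  shows "[coeff (w e) 0 = (if Min (fst e) \<in> T then
     - c (fst e) * ((-1) ^ card (snd e) * (\<Prod>k\<in>T - {Min (fst e)}. - pt e k)) else 0)] (mod p)"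
proof (cases "Min (fst e) \<in> T")
  case True
  let ?K = "T - {Min (fst e)}"
  have "?K \<subseteq> {1..n}" "card ?K = t - 1"
    using T True by (auto simp: tsets_def card_Diff_singleton)
  moreover have "p dvd poly (w e) (pt e k)" if "k \<in> ?K" for k
    using z[of k] that by (simp add: val_def)
  ultimately have 1: "[coeff (w e) 0 = coeff (w e) (t - 1) * coeff (\<Prod>k\<in>?K. [:- pt e k, 1:]) 0] (mod p)"
    using assms(2) by (intro cong_coeff_if_vanishing)
  have "p dvd coeff (w e) (t - 1) + (-1) ^ card (snd e) * c (fst e)"
    using z[OF True] by (simp add: val_def)
  then have 2: "[coeff (w e) (t - 1) = - ((-1) ^ card (snd e) * c (fst e))] (mod p)"
    by (simp add: cong_iff_dvd_diff)
  have 3: "coeff (\<Prod>k\<in>?K. [:- pt e k, 1:]) 0 = (\<Prod>k\<in>?K. - pt e k)"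
    by (simp add: poly_0_coeff_0[symmetric] poly_prod)
  show ?thesis
    using cong_trans[OF 1 cong_mult[OF 2 cong_refl]] True by (simp add: 3 mult_ac)
next
  case False
  then have "p dvd poly (w e) (pt e k)" if "k \<in> T" for k
    using z[of k] that by (auto simp: val_def split: if_splits)
  then have "p dvd coeff (w e) 0"
    using T assms(2) by (intro dvd_coeff_if_vanishing[of T "w e" e]) (auto simp: tsets_def)
  then show ?thesis using False by (simp add: cong_0_iff)
qed

lemma Min_mem_tset: "T \<in> tsets n t \<Longrightarrow> Min T \<in> T"
  using t_pos by (intro Min_in) (auto simp: tsets_def intro: finite_subset)

text \<open>The linear equation becomes a signed sum over all components. For fixed \<open>S\<close>
  the sum over \<open>U\<close> is a mixed difference of a product over \<open>T - {Min S}\<close>,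
  which survives only if \<open>S \<subseteq> T\<close>, that is \<open>S = T\<close>; what remains
  is \<open>- c T\<close>.\<close>

lemma dvd_label_if_val_vanishing:
  assumes T: "T \<in> tsets n t" and deg: "\<And>e. e \<in> comps n t \<Longrightarrow> degree (w e) < t"
    and sum0: "p dvd (\<Sum>e\<in>comps n t. coeff (w e) 0)"
    and z: "\<And>e k. e \<in> comps n t \<Longrightarrow> k \<in> T \<Longrightarrow> p dvd val t c w e k"
  shows "p dvd c T"
proof -
  define h where "h e = (if Min (fst e) \<in> T then
     - c (fst e) * ((-1) ^ card (snd e) * (\<Prod>k\<in>T - {Min (fst e)}. - pt e k)) else 0)" for e
  have finT: "finite T" using T by (rule finite_tset)
  have "[(\<Sum>e\<in>comps n t. coeff (w e) 0) = (\<Sum>e\<in>comps n t. h e)] (mod p)"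
    unfolding h_def using T deg z by (intro cong_sum cong_constant_coeff) auto
  then have "p dvd (\<Sum>e\<in>comps n t. h e)"
    using sum0 by (simp add: cong_dvd_iff)
  also have "(\<Sum>e\<in>comps n t. h e) = (\<Sum>S\<in>tsets n t. \<Sum>U\<in>Pow (S - {Min S}). h (S, U))"
    unfolding comps_def
    by (subst sum.Sigma) (auto simp: finite_tset)
  also have "\<dots> = (\<Sum>S\<in>tsets n t. if S = T then - c T else 0)"
  proof (rule sum.cong[OF refl])
    fix S assume S: "S \<in> tsets n t"
    have finS: "finite S" using S by (rule finite_tset)
    show "(\<Sum>U\<in>Pow (S - {Min S}). h (S, U)) = (if S = T then - c T else 0)"
    proof (cases "Min S \<in> T")
      case False
      then show ?thesis using Min_mem_tset[OF S] by (auto simp: h_def)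
    next
      case True
      have "(\<Sum>U\<in>Pow (S - {Min S}). h (S, U)) = - c S * (\<Sum>U\<in>Pow (S - {Min S}). (-1) ^ card U *
          (\<Prod>k\<in>T - {Min S}. if k \<in> U then - (2 * int k + 1) else - (2 * int k)))"
        using True by (simp add: h_def pt_def sum_distrib_left if_distrib[of uminus] cong: if_cong)
      \<comment> \<open>Here \<open>a k - b k = 1\<close>, so the product of differences disappears;
        for \<open>S = T\<close> the other product is empty.\<close>
      also have "\<dots> = - c S * (if S - {Min S} \<subseteq> T - {Min S} then
          (\<Prod>k\<in>T - {Min S} - (S - {Min S}). - (2 * int k)) else 0)"
        using finS finT by (subst alternating_sum_prod) auto
      also have "S - {Min S} \<subseteq> T - {Min S} \<longleftrightarrow> S = T"
      proof
        assume "S - {Min S} \<subseteq> T - {Min S}"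
        then have "S \<subseteq> T" using True by auto
        then show "S = T" using S T finT by (intro card_subset_eq) (auto simp: tsets_def)
      qed simp
      finally show ?thesis by simp
    qed
  qed
  also have "\<dots> = - c T" using T by simp
  finally show ?thesis by simp
qed

text \<open>Codewords are pairs of a message and a solution of one linear equation in
  \<open>t * card (comps n t)\<close> coefficients. Equality on a \<open>t\<close>-set forces equal
  labels there, so \<open>lab2\<close> bounds agreements by \<open>t\<close> and \<open>lab1\<close>
  puts those of size \<open>t\<close> into \<open>Fam x\<close>; \<open>own\<close> keeps the
  encoding injective.\<close>

lemma max_frameproof_ge_if_labelled:
  fixes M :: "'m set" and lab :: "nat set \<Rightarrow> 'm \<Rightarrow> 'v" and Fam :: "'m \<Rightarrow> nat set set"
  assumes finM: "finite M" and p_pos: "p > 0"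
    and free: "\<And>x. x \<in> M \<Longrightarrow> disjoint_seq_free n l (s + 1) (c - s + 1) (Fam x)"
    and own: "\<And>x. x \<in> M \<Longrightarrow> \<exists>T\<in>tsets n t. T \<notin> Fam x"
    and lab1: "\<And>x y T. x \<in> M \<Longrightarrow> y \<in> M \<Longrightarrow> T \<in> tsets n t \<Longrightarrow> lab T x = lab T y \<Longrightarrow> x \<noteq> y \<Longrightarrow>
      T \<in> Fam x"
    and lab2: "\<And>x y T T'. x \<in> M \<Longrightarrow> y \<in> M \<Longrightarrow> T \<in> tsets n t \<Longrightarrow> T' \<in> tsets n t \<Longrightarrow> T \<noteq> T' \<Longrightarrow>
      lab T x = lab T y \<Longrightarrow> lab T' x = lab T' y \<Longrightarrow> x = y"
    and card_lab: "\<And>T. T \<in> tsets n t \<Longrightarrow> card (lab T ` M) \<le> nat p"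
    and q: "nat p ^ card (comps n t) \<le> q"
    and eq: "c * t + l = s * n + c" and "l \<le> c" and "s \<le> c"
  shows "card M * nat p ^ (t * card (comps n t) - 1) \<le> max_frameproof q c s n"
proof (cases "M = {}")
  case False
  let ?E = "comps n t"
  obtain T0 where T0: "T0 \<in> tsets n t" using False own by blast
  define e0 where "e0 = (T0, {} :: nat set)"
  have e0: "e0 \<in> ?E" using T0 by (simp add: e0_def comps_def)
  have "\<exists>f. f ` (lab T ` M) \<subseteq> {0..<p} \<and> inj_on f (lab T ` M)" if "T \<in> tsets n t" for T
    using card_lab[OF that] finM by (intro card_le_inj) auto
  then obtain num where num: "\<And>T. T \<in> tsets n t \<Longrightarrow> num T ` (lab T ` M) \<subseteq> {0..<p}"
    "\<And>T. T \<in> tsets n t \<Longrightarrow> inj_on (num T) (lab T ` M)"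
    by metis
  define a where "a x T = num T (lab T x)" for x T
  define I where "I = ?E \<times> {..<t} - {(e0, 0)}"
  define W where "W = I \<rightarrow>\<^sub>E {0..<p}"
  \<comment> \<open>The equation is solved for the constant coefficient of the arbitrary component
    \<open>e0\<close>. This value is not reduced modulo \<open>p\<close>; the letters are.\<close>
  define full where "full w = (\<lambda>x. if x = (e0, 0) then - (\<Sum>e\<in>?E - {e0}. w (e, 0)) else w x)"
    for w :: "(nat set \<times> nat set) \<times> nat \<Rightarrow> int"
  define pw where "pw w e = (\<Sum>j<t. monom (full w (e, j)) j)" for w e
  have coeff_pw: "coeff (pw w e) j = (if j < t then full w (e, j) else 0)" for w e j
    by (simp add: pw_def coeff_sum)
  have deg_pw: "degree (pw w e) < t" for w e
    using t_pos coeff_pw[of w e] by (intro le_less_trans[OF degree_le[of "t - 1"]]) auto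
  have sum_pw: "(\<Sum>e\<in>?E. coeff (pw w e) 0) = 0" for w
  proof -
    have "(\<Sum>e\<in>?E. coeff (pw w e) 0) = full w (e0, 0) + (\<Sum>e\<in>?E - {e0}. full w (e, 0))"
      using e0 t_pos by (simp add: coeff_pw sum.remove)
    also have "(\<Sum>e\<in>?E - {e0}. full w (e, 0)) = (\<Sum>e\<in>?E - {e0}. w (e, 0))"
      by (rule sum.cong) (auto simp: full_def)
    finally show ?thesis by (simp add: full_def)
  qed
  have finI: "finite I" and cardI: "card I = t * card ?E - 1"
    using e0 t_pos by (simp_all add: I_def card_Diff_singleton mult.commute)
  have finW: "finite W" and cardW: "card W = nat p ^ (t * card ?E - 1)"
    using finI cardI by (simp_all add: W_def finite_PiE card_PiE)
  define A where "A = ?E \<rightarrow>\<^sub>E {0..<p}"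
  have "\<exists>h. h ` A \<subseteq> {1..q} \<and> inj_on h A"
    using q by (intro card_le_inj) (auto simp: A_def finite_PiE card_PiE)
  then obtain h where h: "h ` A \<subseteq> {1..q}" "inj_on h A" by blast
  define letter where "letter x w k = (\<lambda>e\<in>?E. val t (a x) (pw w) e k mod p)" for x w k
  have letter: "letter x w k \<in> A" for x w k
    using p_pos by (auto simp: A_def letter_def)
  define cw where "cw = (\<lambda>(x, w). \<lambda>k\<in>{1..n}. h (letter x w k))"
  \<comment> \<open>\<open>val\<close> is linear in labels and polynomials jointly, so agreement on
    \<open>T\<close> gives a word for the difference labels that vanishes on
    \<open>T\<close>.\<close>
  have agree: "lab T x = lab T y \<and> (x = y \<longrightarrow> w = v)"
    if x: "x \<in> M" "y \<in> M" "w \<in> W" "v \<in> W" and T: "T \<in> tsets n t"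
      and ag: "\<And>k. k \<in> T \<Longrightarrow> cw (x, w) k = cw (y, v) k" for x y w v T
  proof
    have dvd: "p dvd val t (\<lambda>S. a x S - a y S) (\<lambda>e. pw w e - pw v e) e k"
      if "e \<in> ?E" "k \<in> T" for e k
    proof -
      have "k \<in> {1..n}" using T \<open>k \<in> T\<close> by (auto simp: tsets_def)
      then have "letter x w k = letter y v k"
        using ag[OF \<open>k \<in> T\<close>] inj_onD[OF h(2) _ letter letter] by (simp add: cw_def)
      then have "val t (a x) (pw w) e k mod p = val t (a y) (pw v) e k mod p"
        using \<open>e \<in> ?E\<close> by (auto simp: letter_def dest: fun_cong[of _ _ e])
      then show ?thesis by (simp add: val_diff mod_eq_dvd_iff)
    qed
    have deg: "degree (pw w e - pw v e) < t" for e
      using deg_pw by (intro le_less_trans[OF degree_diff_le_max]) auto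
    have "p dvd a x T - a y T"
    proof (rule dvd_label_if_val_vanishing[of T "\<lambda>e. pw w e - pw v e" "\<lambda>S. a x S - a y S"])
      show "p dvd (\<Sum>e\<in>?E. coeff (pw w e - pw v e) 0)"
        using sum_pw by (simp add: sum_subtractf)
    qed (use T deg dvd in auto)
    moreover have "a x T \<in> {0..<p}" "a y T \<in> {0..<p}"
      using num(1)[OF T] x unfolding a_def by blast+
    ultimately have "a x T = a y T"
      by (simp add: mod_eq_dvd_iff[symmetric])
    then show "lab T x = lab T y"
      using num(2)[OF T] x by (auto simp: a_def inj_on_def)
    show "x = y \<longrightarrow> w = v"
    proof
      assume "x = y"
      show "w = v"
      proof (rule PiE_ext)
        show "w \<in> I \<rightarrow>\<^sub>E {0..<p}" "v \<in> I \<rightarrow>\<^sub>E {0..<p}" using x by (auto simp: W_def)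
        fix z assume z: "z \<in> I"
        obtain e j where ej: "z = (e, j)" by (cases z)
        have "p dvd coeff (pw w e - pw v e) j"
          using dvd_coeff_if_val_vanishing[OF T, of "\<lambda>e. pw w e - pw v e" e] deg dvd z ej \<open>x = y\<close>
          by (auto simp: I_def)
        then have "p dvd w z - v z"
          using z ej by (auto simp: coeff_pw full_def I_def)
        moreover have "w z \<in> {0..<p}" "v z \<in> {0..<p}"
          using x(3,4) z by (auto simp: W_def dest: PiE_mem)
        ultimately show "w z = v z"
          by (simp add: mod_eq_dvd_iff[symmetric])
      qed
    qed
  qed
  have inj: "inj_on cw (M \<times> W)"
  proof (rule inj_onI, clarify)
    fix x w y v
    assume x: "x \<in> M" "w \<in> W" "y \<in> M" "v \<in> W" and e: "cw (x, w) = cw (y, v)"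
    \<comment> \<open>The label of \<open>x\<close> at a \<open>t\<close>-set outside
      \<open>Fam x\<close> is shared with no other message.\<close>
    obtain T where T: "T \<in> tsets n t" "T \<notin> Fam x" using own x by blast
    have "lab T x = lab T y \<and> (x = y \<longrightarrow> w = v)"
      using x T e by (intro agree) auto
    then show "x = y \<and> w = v" using lab1[of x y T] x T by blast
  qed
  define C where "C = cw ` (M \<times> W)"
  have "C \<subseteq> words q n"
    using h(1) letter by (auto simp: C_def cw_def words_def)
  moreover have "frameproof c s n C"
  proof (rule frameproof_if_agreements[OF eq \<open>l \<le> c\<close> \<open>s \<le> c\<close>])
    fix X assume "X \<in> C"
    then obtain x w where X: "x \<in> M" "w \<in> W" "X = cw (x, w)" by (auto simp: C_def)
    have "card {i\<in>{1..n}. Y i = X i} \<le> t \<and>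
         (card {i\<in>{1..n}. Y i = X i} = t \<longrightarrow> {i\<in>{1..n}. Y i = X i} \<in> Fam x)"
      if Y: "Y \<in> C" "Y \<noteq> X" for Y
    proof -
      obtain y v where Y: "y \<in> M" "v \<in> W" "Y = cw (y, v)" "(x, w) \<noteq> (y, v)"
        using Y X by (auto simp: C_def)
      let ?B = "{i\<in>{1..n}. Y i = X i}"
      have eqT: "lab T x = lab T y \<and> x \<noteq> y" if "T \<subseteq> ?B" "card T = t" for T
      proof -
        have "lab T x = lab T y \<and> (x = y \<longrightarrow> w = v)"
          using that X Y by (intro agree) (auto simp: tsets_def subset_iff)
        then show ?thesis using Y(4) by blast
      qed
      have "card ?B \<le> t"
      proof (rule ccontr)
        assume "\<not> ?thesis"
        then have "Suc t \<le> card ?B" by simp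
        then obtain D where D: "D \<subseteq> ?B" "card D = Suc t" "finite D"
          by (rule obtain_subset_with_card_n)
        \<comment> \<open>At least two agreeing coordinates give two distinct
          \<open>t\<close>-subsets of \<open>D\<close>; equal labels on both would force
          \<open>x = y\<close>.\<close>
        have "\<not> card D \<le> Suc 0" unfolding D(2) using t_pos by linarith
        then obtain u u' where u: "u \<in> D" "u' \<in> D" "u \<noteq> u'"
          using card_le_Suc0_iff_eq[OF D(3)] by blast
        have "D - {u} \<noteq> D - {u'}" using u by blast
        moreover have "D - {u} \<subseteq> ?B" "card (D - {u}) = t" "D - {u'} \<subseteq> ?B" "card (D - {u'}) = t"
          using D u by auto
        moreover from this have "D - {u} \<in> tsets n t" "D - {u'} \<in> tsets n t"
          by (auto simp: tsets_def)
        ultimately show False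
          using eqT[of "D - {u}"] eqT[of "D - {u'}"] lab2[of x y "D - {u}" "D - {u'}"] X(1) Y(1)
          by blast
      qed
      moreover have "?B \<in> Fam x" if "card ?B = t"
      proof -
        have "?B \<in> tsets n t" using that by (auto simp: tsets_def)
        then show ?thesis using eqT[of ?B] that lab1[of x y ?B] X(1) Y(1) by blast
      qed
      ultimately show ?thesis by blast
    qed
    then show "\<exists>F. disjoint_seq_free n l (s + 1) (c - s + 1) F \<and>
      (\<forall>Y\<in>C. Y \<noteq> X \<longrightarrow> card {i\<in>{1..n}. Y i = X i} \<le> t \<and>
         (card {i\<in>{1..n}. Y i = X i} = t \<longrightarrow> {i\<in>{1..n}. Y i = X i} \<in> F))"
      using free[OF X(1)] by blast
  qed
  ultimately have "card C \<le> max_frameproof q c s n"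
    unfolding max_frameproof_def by (intro Max_ge max_frameproof_wf) auto
  moreover have "card C = card M * nat p ^ (t * card ?E - 1)"
    using inj by (simp add: C_def card_image card_cartesian_product cardW)
  ultimately show ?thesis by simp
qed simp

end

section \<open>Labels from extremal families\<close>

lemma disjoint_seq_free_image:
  assumes pi: "bij_betw \<pi> {1..n} {1..n}" and F: "F \<subseteq> Pow {1..n}"
    and free: "disjoint_seq_free n l k1 k2 F"
  shows "disjoint_seq_free n l k1 k2 ((`) \<pi> ` F)"
  unfolding disjoint_seq_free_def
proof (intro notI, elim exE conjE)
  fix A assume A: "\<forall>i\<in>{1..l}. A i \<in> (`) \<pi> ` F" and dis: "disjoint_seq n l k1 k2 A"
  then obtain A' where A': "\<And>i. i \<in> {1..l} \<Longrightarrow> A' i \<in> F" "\<And>i. i \<in> {1..l} \<Longrightarrow> A i = \<pi> ` A' i"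
    unfolding image_iff by metis
  have "(\<Inter>i\<in>B. A' i) = {}" if B: "B \<subseteq> {1..l}" "card B = k1" for B
  proof (rule ccontr)
    assume "(\<Inter>i\<in>B. A' i) \<noteq> {}"
    then obtain z where "\<And>i. i \<in> B \<Longrightarrow> z \<in> A' i" by blast
    then have "\<pi> z \<in> (\<Inter>i\<in>B. A i)" using A'(2) B(1) by blast
    then show False using dis B unfolding disjoint_seq_def by blast
  qed
  moreover have "(\<Union>i\<in>B. A' i) = {1..n}" if B: "B \<subseteq> {1..l}" "card B = k2" for B
  proof -
    have "\<pi> ` (\<Union>i\<in>B. A' i) = (\<Union>i\<in>B. A i)" using A'(2) B(1) by blast
    also have "\<dots> = \<pi> ` {1..n}"
      using dis B pi by (simp add: disjoint_seq_def bij_betw_def)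
    finally have eq: "\<pi> ` (\<Union>i\<in>B. A' i) = \<pi> ` {1..n}" .
    have "(\<Union>i\<in>B. A' i) \<subseteq> {1..n}" using A'(1) B(1) F by blast
    then show ?thesis
      using eq pi by (metis bij_betw_def inj_on_image_eq_iff order_refl)
  qed
  ultimately have "disjoint_seq n l k1 k2 A'" by (simp add: disjoint_seq_def)
  then show False using free A'(1) unfolding disjoint_seq_free_def by blast
qed

lemma ex_perm_mapping_tset:
  assumes "T \<in> tsets n t" "T' \<in> tsets n t"
  obtains \<pi> where "bij_betw \<pi> {1..n} {1..n}" "\<pi> ` T = T'"
proof -
  have T: "T \<subseteq> {1..n}" "T' \<subseteq> {1..n}" "card T = t" "card T' = t" "finite T" "finite T'"
    using assms assms[THEN finite_tset] by (simp_all add: tsets_def)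
  obtain f where f: "bij_betw f T T'"
    using T by (metis finite_same_card_bij)
  obtain g where g: "bij_betw g ({1..n} - T) ({1..n} - T')"
    using T by (metis card_Diff_subset finite_Diff finite_atLeastAtMost finite_same_card_bij)
  let ?h = "\<lambda>x. if x \<in> T then f x else g x"
  have 1: "bij_betw ?h T T'" using f by (subst bij_betw_cong[of T ?h f]) auto
  have 2: "bij_betw ?h ({1..n} - T) ({1..n} - T')"
    using g by (subst bij_betw_cong[of _ ?h g]) auto
  have "bij_betw ?h (T \<union> ({1..n} - T)) (T' \<union> ({1..n} - T'))"
    by (rule bij_betw_combine[OF 1 2]) auto
  then have "bij_betw ?h {1..n} {1..n}"
    using T by (simp add: Un_absorb1)
  moreover have "?h ` T = T'" using 1 by (simp add: bij_betw_def)
  ultimately show ?thesis by (rule that)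
qed

definition extremal :: "nat \<Rightarrow> nat \<Rightarrow> nat \<Rightarrow> nat \<Rightarrow> nat \<Rightarrow> nat set set set" where
  "extremal n t l k1 k2 = {F. F \<subseteq> tsets n t \<and> disjoint_seq_free n l k1 k2 F \<and>
     card F = max_disjoint_seq_free n t l k1 k2}"

lemma finite_extremal [simp]: "finite (extremal n t l k1 k2)"
  by (auto simp: extremal_def intro: finite_subset[of _ "Pow (tsets n t)"])

lemma extremal_nonempty: "1 \<le> l \<Longrightarrow> extremal n t l k1 k2 \<noteq> {}"
  using Max_in[OF max_disjoint_seq_free_wf(1) max_disjoint_seq_free_wf(2), of l n t k1 k2]
  unfolding extremal_def max_disjoint_seq_free_def tsets_def by auto

text \<open>A permutation taking \<open>S\<close> to \<open>S'\<close> maps the extremal families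
  containing \<open>S\<close> injectively to those containing \<open>S'\<close>. So their number is
  the same for all \<open>t\<close>-sets, and counting incident pairs of a \<open>t\<close>-set and
  a family gives its value.\<close>

lemma card_extremal_containing:
  assumes T: "T \<in> tsets n t"
  shows "(n choose t) * card {F \<in> extremal n t l k1 k2. T \<in> F} =
    card (extremal n t l k1 k2) * max_disjoint_seq_free n t l k1 k2"
proof -
  let ?X = "extremal n t l k1 k2"
  have le: "card {F \<in> ?X. S \<in> F} \<le> card {F \<in> ?X. S' \<in> F}"
    if S: "S \<in> tsets n t" "S' \<in> tsets n t" for S S'
  proof -
    obtain \<pi> where pi: "bij_betw \<pi> {1..n} {1..n}" "\<pi> ` S = S'"
      using ex_perm_mapping_tset[OF S] .
    have inj: "inj_on ((`) \<pi>) (Pow {1..n})"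
      using pi by (auto simp: bij_betw_def intro: inj_on_image_Pow)
    have sub: "F \<subseteq> Pow {1..n}" if "F \<in> ?X" for F
      using that by (auto simp: extremal_def tsets_def)
    have mem: "(`) \<pi> ` F \<in> ?X" if F: "F \<in> ?X" for F
    proof -
      have "card ((`) \<pi> ` F) = card F"
        using inj sub[OF F] by (intro card_image) (rule inj_on_subset)
      moreover have "\<pi> ` R \<in> tsets n t" if "R \<in> tsets n t" for R
      proof -
        have "inj_on \<pi> R" "R \<subseteq> {1..n}"
          using pi that by (auto simp: bij_betw_def tsets_def intro: inj_on_subset)
        then show ?thesis
          using pi that by (auto simp: bij_betw_def tsets_def card_image)
      qed
      ultimately show ?thesis
        using F disjoint_seq_free_image[OF pi(1) sub[OF F]] by (auto simp: extremal_def)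
    qed
    show ?thesis
    proof (rule card_inj_on_le)
      show "inj_on ((`) ((`) \<pi>)) {F \<in> ?X. S \<in> F}"
        using inj_on_image_Pow[OF inj] sub by (auto intro: inj_on_subset)
      show "(`) ((`) \<pi>) ` {F \<in> ?X. S \<in> F} \<subseteq> {F \<in> ?X. S' \<in> F}"
        using mem pi(2) by blast
    qed simp
  qed
  have "(\<Sum>S\<in>tsets n t. card {F \<in> ?X. S \<in> F}) = (\<Sum>S\<in>tsets n t. card {F \<in> ?X. T \<in> F})"
    using le T by (intro sum.cong) (auto intro: antisym)
  then have "(n choose t) * card {F \<in> ?X. T \<in> F} = (\<Sum>S\<in>tsets n t. card {F \<in> ?X. S \<in> F})"
    by (simp add: card_tsets)
  also have "\<dots> = (\<Sum>F\<in>?X. card {S \<in> tsets n t. S \<in> F})"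
    by (rule sum_multicount_gen) auto
  also have "\<dots> = (\<Sum>F\<in>?X. max_disjoint_seq_free n t l k1 k2)"
  proof (rule sum.cong[OF refl])
    fix F assume "F \<in> ?X"
    then have "{S \<in> tsets n t. S \<in> F} = F" "card F = max_disjoint_seq_free n t l k1 k2"
      by (auto simp: extremal_def)
    then show "card {S \<in> tsets n t. S \<in> F} = max_disjoint_seq_free n t l k1 k2" by simp
  qed
  finally show ?thesis by simp
qed

text \<open>A message consists of a level, an extremal family \<open>F\<close> and a vector \<open>u\<close> indexed by \<open>F\<close>;
  its label at \<open>T\<close> forgets the entry \<open>u T\<close>. Hence the \<open>T\<close>-label is private unless \<open>T \<in> F\<close>, and
  then it is shared by \<open>K\<close> messages, so that the shared labels hardly count.\<close>

lemma max_frameproof_ge_levels: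
  fixes n c s t l K :: nat
  defines "b \<equiv> n choose t" and "m \<equiv> max_disjoint_seq_free n t l (s + 1) (c - s + 1)"
  assumes "1 \<le> t" and "1 \<le> l" and "m < b" and "1 \<le> K"
    and eq: "c * t + l = s * n + c" and "l \<le> c" and "s \<le> c"
  obtains N V where "0 < V" and "b * K * V = N * (K * (b - m) + m)"
    and "\<And>L p q. (\<And>d. 1 \<le> d \<Longrightarrow> d \<le> 2 * n \<Longrightarrow> coprime p d) \<Longrightarrow> 0 < p \<Longrightarrow> L * V \<le> p \<Longrightarrow>
      p ^ card (comps n t) \<le> q \<Longrightarrow>
      L * N * p ^ (t * card (comps n t) - 1) \<le> max_frameproof q c s n"
proof -
  let ?X = "extremal n t l (s + 1) (c - s + 1)"
  define N where "N = card ?X * K ^ m"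
  have X: "F \<subseteq> tsets n t" "finite F" "card F = m" "disjoint_seq_free n l (s + 1) (c - s + 1) F"
    if "F \<in> ?X" for F
    using that by (auto simp: extremal_def m_def intro: finite_subset)
  \<comment> \<open>\<open>cnt T\<close> counts the possible labels at \<open>T\<close> within one
    level. A fraction \<open>m / b\<close> of the families contain \<open>T\<close> and contribute
    \<open>K ^ (m - 1)\<close> each, the others \<open>K ^ m\<close>; the factor
    \<open>b * K\<close> clears denominators.\<close>
  define cnt where "cnt T = (\<Sum>F\<in>?X. K ^ card (F - {T}))" for T
  have cnt: "b * K * cnt T = N * (K * (b - m) + m)" if T: "T \<in> tsets n t" for T
  proof -
    let ?X1 = "{F \<in> ?X. T \<in> F}"
    have "K * K ^ card (F - {T}) = (if T \<in> F then K ^ m else K * K ^ m)" if "F \<in> ?X" for F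
    proof (cases "T \<in> F")
      case True
      then have "m = Suc (card (F - {T}))"
        using X[OF that] by (metis card_Suc_Diff1)
      then show ?thesis using True by simp
    qed (use X[OF that] in simp)
    then have "K * cnt T = (\<Sum>F\<in>?X. if T \<in> F then K ^ m else K * K ^ m)"
      by (simp add: cnt_def sum_distrib_left)
    also have "\<dots> = card ?X1 * K ^ m + card (?X - ?X1) * (K * K ^ m)"
      by (simp add: sum.If_cases Int_def set_diff_eq conj_commute cong: conj_cong) 
    finally have 1: "K * cnt T = K ^ m * (card ?X1 + card (?X - ?X1) * K)"
      by (simp add: algebra_simps)
    have 2: "b * card ?X1 = card ?X * m"
      using card_extremal_containing[OF T] by (simp add: b_def m_def)
    have "card (?X - ?X1) = card ?X - card ?X1" by (rule card_Diff_subset) auto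
    then have 3: "b * card (?X - ?X1) = card ?X * (b - m)"
      using 2 by (simp add: diff_mult_distrib diff_mult_distrib2 mult.commute)
    have "b * K * cnt T = b * (K * cnt T)" by simp
    also have "\<dots> = K ^ m * (b * card ?X1 + (b * card (?X - ?X1)) * K)"
      unfolding 1 by (simp only: algebra_simps)
    also have "\<dots> = N * (K * (b - m) + m)"
      unfolding 2 3 by (simp add: N_def algebra_simps)
    finally show ?thesis .
  qed
  obtain T0 where T0: "T0 \<in> tsets n t"
    using \<open>m < b\<close> card_tsets[of n t] by (metis b_def card.empty ex_in_conv not_less_zero)
  define V where "V = cnt T0"
  have V: "cnt T = V" if "T \<in> tsets n t" for T
  proof -
    have "b * K * cnt T = b * K * V" using cnt[OF that] cnt[OF T0] by (simp add: V_def)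
    then show ?thesis using \<open>m < b\<close> \<open>1 \<le> K\<close> by simp
  qed
  have "0 < N" using extremal_nonempty[OF \<open>1 \<le> l\<close>] \<open>1 \<le> K\<close> by (simp add: N_def card_gt_0_iff)
  then have "0 < N * (K * (b - m) + m)" using \<open>m < b\<close> \<open>1 \<le> K\<close> by simp
  then have "0 < V" using cnt[OF T0] by (metis V_def gr0I mult_0_right less_irrefl)
  show ?thesis
  proof (rule that[OF \<open>0 < V\<close>])
    show "b * K * V = N * (K * (b - m) + m)" using cnt[OF T0] by (simp add: V_def)
    fix L p q :: nat
    assume cop: "\<And>d. 1 \<le> d \<Longrightarrow> d \<le> 2 * n \<Longrightarrow> coprime p d" and p: "0 < p" "L * V \<le> p"
      and q: "p ^ card (comps n t) \<le> q"
    interpret evaluation_modulus n t "int p"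
    proof
      fix d :: int assume "1 \<le> d" "d \<le> 2 * int n"
      then have "coprime p (nat d)" by (intro cop) auto
      then have "coprime (int p) (int (nat d))" by (simp only: coprime_int_iff)
      then show "coprime (int p) d" using \<open>1 \<le> d\<close> by simp
    qed (rule \<open>1 \<le> t\<close>)
    define M where "M = {..<L} \<times> (SIGMA F:?X. F \<rightarrow>\<^sub>E {..<K})"
    \<comment> \<open>\<open>undefined\<close> is the value of an extensional function off its
      domain: the label lies over \<open>F - {T}\<close>, and nothing is lost if
      \<open>T \<notin> F\<close>.\<close>
    define lab where "lab T = (\<lambda>(i :: nat, F :: nat set set, u :: nat set \<Rightarrow> nat). (i, F, u(T := undefined)))"
      for T
    have fin: "finite (SIGMA F:?X. F \<rightarrow>\<^sub>E {..<K})"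
      using X(2) by (intro finite_SigmaI finite_PiE) auto
    have "card M = L * (\<Sum>F\<in>?X. card (F \<rightarrow>\<^sub>E {..<K}))"
      using X(2) by (simp add: M_def card_cartesian_product card_SigmaI finite_PiE)
    also have "(\<Sum>F\<in>?X. card (F \<rightarrow>\<^sub>E {..<K})) = (\<Sum>F\<in>?X. K ^ m)"
      using X(2,3) by (intro sum.cong) (auto simp: card_PiE)
    finally have cardM: "card M = L * N" by (simp add: N_def)
    have card_lab: "card (lab T ` M) \<le> p" if T: "T \<in> tsets n t" for T
    proof -
      let ?Y = "{..<L} \<times> (SIGMA F:?X. (F - {T}) \<rightarrow>\<^sub>E {..<K})"
      have "finite ?Y" using X(2) by (intro finite_cartesian_product finite_SigmaI finite_PiE) auto
      moreover have "lab T ` M \<subseteq> ?Y" by (auto simp: lab_def M_def PiE_iff extensional_def split: if_splits)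
      ultimately have "card (lab T ` M) \<le> card ?Y" by (rule card_mono)
      also have "card ?Y = L * (\<Sum>F\<in>?X. card ((F - {T}) \<rightarrow>\<^sub>E {..<K}))"
        using X(2) by (simp add: card_cartesian_product card_SigmaI finite_PiE)
      also have "(\<Sum>F\<in>?X. card ((F - {T}) \<rightarrow>\<^sub>E {..<K})) = cnt T"
        unfolding cnt_def using X(2) by (intro sum.cong) (auto simp: card_PiE)
      also have "L * cnt T \<le> p" using V[OF T] p by simp
      finally show ?thesis .
    qed
    have lab_eqD: "i = j \<and> F = G \<and> (\<forall>R. R \<noteq> T \<longrightarrow> u R = v R)"
      if "lab T (i, F, u) = lab T (j, G, v)" for T i j F G u v
      using that by (auto simp: lab_def fun_upd_def fun_eq_iff split: if_splits)
    have "card M * nat (int p) ^ (t * card (comps n t) - 1) \<le> max_frameproof q c s n"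
    proof (rule max_frameproof_ge_if_labelled[where lab = lab and Fam = "\<lambda>x. fst (snd x)"])
      show "finite M" using fin by (simp add: M_def)
      fix x assume x: "x \<in> M"
      then have F: "fst (snd x) \<in> ?X" by (auto simp: M_def)
      then show "disjoint_seq_free n l (s + 1) (c - s + 1) (fst (snd x))" by (rule X)
      show "\<exists>T\<in>tsets n t. T \<notin> fst (snd x)"
      proof (rule ccontr)
        assume "\<not> ?thesis"
        then have "fst (snd x) = tsets n t" using X(1)[OF F] by blast
        then show False using X(3)[OF F] \<open>m < b\<close> by (simp add: card_tsets b_def)
      qed
      fix y T assume y: "y \<in> M" "T \<in> tsets n t" "lab T x = lab T y"
      obtain i F u where xe: "x = (i, F, u)" by (cases x)
      obtain j G v where ye: "y = (j, G, v)" by (cases y)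
      note eqs = lab_eqD[OF y(3)[unfolded xe ye]]
      have u: "u \<in> F \<rightarrow>\<^sub>E {..<K}" "v \<in> F \<rightarrow>\<^sub>E {..<K}"
        using x y(1) eqs by (auto simp: M_def xe ye)
      show "T \<in> fst (snd x)" if "x \<noteq> y"
      proof (rule ccontr)
        assume "T \<notin> fst (snd x)"
        then have "u T = v T" using u by (auto simp: xe PiE_def extensional_def)
        then have "u = v" using eqs by (metis ext)
        then show False using that eqs by (simp add: xe ye)
      qed
      \<comment> \<open>The only entry forgotten at \<open>T\<close> is \<open>u T\<close>, which
        the label at \<open>T'\<close> retains.\<close>
      show "x = y" if "T' \<in> tsets n t" "T \<noteq> T'" "lab T' x = lab T' y" for T'
      proof -
        have "u = v" using eqs lab_eqD[OF that(3)[unfolded xe ye]] that(2) by (metis ext)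
        then show ?thesis using eqs by (simp add: xe ye)
      qed
    qed (use card_lab p q eq assms in auto)
    then show "L * N * p ^ (t * card (comps n t) - 1) \<le> max_frameproof q c s n"
      by (simp add: cardM)
  qed
qed

section \<open>Asymptotics\<close>

text \<open>Write \<open>s * n = c * d + l\<close>. As the residue is taken in
  \<open>{1..c}\<close>, with \<open>c\<close> in place of 0, rounding up always gives
  \<open>d + 1\<close>.\<close>

lemma nat_ceiling_divide_eq:
  fixes n c s t l :: nat
  assumes "1 \<le> c" "1 \<le> s * n" and t: "t = nat \<lceil>real (s * n) / real c\<rceil>"
    and l: "l \<in> {1..c}" "[l = s * n] (mod c)"
  shows "c * t + l = s * n + c"
proof -
  have "l \<le> s * n"
  proof (rule ccontr)
    assume "\<not> ?thesis"
    then have "s * n < l" by simp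
    moreover have "c dvd l - s * n" using l(2) calculation by (simp add: cong_altdef_nat cong_sym_eq)
    ultimately have "c \<le> l - s * n" by (intro dvd_imp_le) auto
    then show False using l(1) assms(2) unfolding atLeastAtMost_iff by linarith
  qed
  then have "c dvd s * n - l" using cong_sym[OF l(2)] by (simp add: cong_altdef_nat)
  then obtain d where "s * n - l = c * d" by (elim dvdE)
  then have d: "s * n = c * d + l" using \<open>l \<le> s * n\<close> by simp
  have "\<lceil>real (s * n) / real c\<rceil> = int d + 1"
    using l(1) assms(1) unfolding d
    by (intro ceiling_unique) (auto simp: field_simps)
  then have "t = d + 1" using t by simp
  then show ?thesis using d by simp
qed

text \<open>Take the largest such modulus with \<open>E\<close>-th power at most \<open>q\<close>;
  the gap \<open>D\<close> to the next is constant, so the relative loss tends to 0.\<close>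

lemma ex_modulus_below_root:
  fixes D E q :: nat
  assumes "1 \<le> D" "1 \<le> E" "1 \<le> q"
  obtains k where "(D * k + 1) ^ E \<le> q" "q < (D * k + 1 + D) ^ E"
proof -
  let ?P = "\<lambda>k. (D * k + 1) ^ E \<le> q"
  have "k \<le> q" if "?P k" for k
  proof -
    have "k \<le> D * k + 1" using assms(1) by (metis le_add1 le_trans mult_le_mono1 nat_mult_1)
    also have "\<dots> \<le> (D * k + 1) ^ E" using assms(2) by (intro self_le_power) auto
    finally show ?thesis using that by simp
  qed
  moreover have "?P 0" using assms by simp
  ultimately obtain k where k: "?P k" "\<And>j. ?P j \<Longrightarrow> j \<le> k"
    using Nat.ex_has_greatest_nat[of ?P 0 q] by metis
  then have "\<not> ?P (Suc k)" by (meson Suc_n_not_le_n)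
  then show ?thesis using k(1) by (intro that[of k]) (auto simp: not_le algebra_simps)
qed

text \<open>With \<open>p\<close> close to the \<open>E\<close>-th root of \<open>q\<close> and
  \<open>L\<close> close to \<open>p / V\<close>, the bound \<open>L * N * p ^ (t * E - 1)\<close>
  is close to \<open>N / V\<close> times \<open>q ^ t\<close>.\<close>

lemma eventually_ratio_gt:
  fixes f :: "nat \<Rightarrow> nat" and N V D E t :: nat
  assumes "1 \<le> D" "1 \<le> E" "1 \<le> t" "0 < V"
    and f: "\<And>L k q. L * V \<le> D * k + 1 \<Longrightarrow> (D * k + 1) ^ E \<le> q \<Longrightarrow>
      L * N * (D * k + 1) ^ (t * E - 1) \<le> f q"
    and r: "r < real N / real V"
  shows "eventually (\<lambda>q. r < real (f q) / real q ^ t) sequentially"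
proof -
  \<comment> \<open>The second factor pays for rounding \<open>p / V\<close> down to
    \<open>L\<close>, the third for replacing \<open>p + D\<close> by \<open>p\<close>.\<close>
  define G where "G p = (real N / real V) * (1 - real V / real p) *
    (1 / (1 + real D / real p)) ^ (t * E)" for p :: nat
  have "G \<longlonglongrightarrow> (real N / real V) * (1 - 0) * (1 / (1 + 0)) ^ (t * E)"
    unfolding G_def by (intro tendsto_intros lim_const_over_n) auto
  then have "eventually (\<lambda>p. r < G p) sequentially"
    using r by (intro order_tendstoD(1)) auto
  then obtain P0 where P0: "\<And>p. P0 \<le> p \<Longrightarrow> r < G p"
    by (auto simp: eventually_sequentially)
  show ?thesis
    unfolding eventually_sequentially
  \<comment> \<open>As \<open>q < (p + D) ^ E\<close>, this threshold forces
    \<open>P0 \<le> p\<close>.\<close>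
  proof (intro exI[of _ "(P0 + D) ^ E + 1"] allI impI)
    fix q assume q: "(P0 + D) ^ E + 1 \<le> q"
    obtain k where k: "(D * k + 1) ^ E \<le> q" "q < (D * k + 1 + D) ^ E"
      using ex_modulus_below_root[of D E q] assms(1,2) q by auto
    define p where "p = D * k + 1"
    have p: "p ^ E \<le> q" "q < (p + D) ^ E" "0 < p" using k by (auto simp: p_def)
    have "P0 \<le> p"
    proof (rule ccontr)
      assume "\<not> ?thesis"
      then have "(p + D) ^ E \<le> (P0 + D) ^ E" by (intro power_mono) auto
      then show False using p(2) q by simp
    qed
    define L where "L = p div V"
    have "L * N * p ^ (t * E - 1) \<le> f q"
      using f[of L k q] p(1) by (simp add: L_def p_def)
    moreover have "real p - real V \<le> real L * real V"
    proof -
      have "p = L * V + p mod V" by (simp add: L_def)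
      moreover have "p mod V < V" using assms(4) by simp
      ultimately have "real p \<le> real (L * V + V)" by linarith
      then show ?thesis by simp
    qed
    then have "(real p - real V) / real V \<le> real L"
      using assms(4) by (simp add: field_simps)
    ultimately have 1: "(real p - real V) / real V * real N * real p ^ (t * E - 1) \<le> real (f q)"
      by (smt (verit) mult_right_mono of_nat_0_le_iff of_nat_le_iff of_nat_mult of_nat_power zero_le_power)
    have "real q ^ t \<le> (real (p + D) ^ E) ^ t"
      using p(2) by (intro power_mono) (auto simp flip: of_nat_power simp del: of_nat_add)
    then have 2: "real q ^ t \<le> real (p + D) ^ (t * E)"
      by (simp add: power_mult[symmetric] mult.commute)
    have "real p ^ (t * E) = real p * real p ^ (t * E - 1)"
      using assms(2,3) by (simp add: power_eq_if)
    moreover have "1 / (1 + real D / real p) * real (p + D) = real p"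
      using p(3) by (simp add: field_simps)
    then have "(1 / (1 + real D / real p)) ^ (t * E) * real (p + D) ^ (t * E) = real p ^ (t * E)"
      by (simp only: power_mult_distrib[symmetric])
    ultimately have G: "G p * real (p + D) ^ (t * E) =
        (real p - real V) / real V * real N * real p ^ (t * E - 1)"
      using p(3) by (simp add: G_def mult.assoc) (simp add: field_simps)
    have "0 < q" using q by simp
    show "r < real (f q) / real q ^ t"
    \<comment> \<open>\<open>G p\<close> can be negative when \<open>p < V\<close>; then
      \<open>r\<close> is negative too and the claim is trivial.\<close>
    proof (cases "0 \<le> G p")
      case True
      have "G p * real q ^ t \<le> real (f q)"
        using mult_left_mono[OF 2 True] G 1 by linarith
      then have "G p \<le> real (f q) / real q ^ t"
        using \<open>0 < q\<close> by (simp add: field_simps)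
      then show ?thesis using P0[OF \<open>P0 \<le> p\<close>] by simp
    next
      case False
      then have "r < 0" using P0[OF \<open>P0 \<le> p\<close>] by simp
      then show ?thesis by (meson divide_nonneg_nonneg less_le_trans of_nat_0_le_iff zero_le_power)
    qed
  qed
qed

text \<open>First \<open>K\<close> is fixed so large that \<open>N / V\<close>, which equals
  \<open>b / ((b - m) + m / K)\<close>, exceeds \<open>r\<close>; only then does \<open>q\<close>
  grow.\<close>

lemma eventually_max_frameproof_gt:
  fixes n c s t l :: nat
  defines "b \<equiv> n choose t" and "m \<equiv> max_disjoint_seq_free n t l (s + 1) (c - s + 1)"
  assumes "1 \<le> t" and "1 \<le> l" and "m < b"
    and eq: "c * t + l = s * n + c" and "l \<le> c" and "s \<le> c"
    and r: "r < real b / (real b - real m)"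
  shows "eventually (\<lambda>q. r < real (max_frameproof q c s n) / real q ^ t) sequentially"
proof -
  have "(\<lambda>K. real b / ((real b - real m) + real m / real K)) \<longlonglongrightarrow> real b / ((real b - real m) + 0)"
    using \<open>m < b\<close> by (intro tendsto_intros lim_const_over_n) auto
  then have "eventually (\<lambda>K. r < real b / ((real b - real m) + real m / real K)) sequentially"
    using r by (intro order_tendstoD(1)) auto
  then have "eventually (\<lambda>K. r < real b / ((real b - real m) + real m / real K) \<and> 1 \<le> K) sequentially"
    using eventually_ge_at_top[of 1] by eventually_elim simp
  then obtain K where K: "r < real b / ((real b - real m) + real m / real K)" "1 \<le> K"
    by (auto simp: eventually_sequentially)
  obtain N V where NV: "0 < V" "b * K * V = N * (K * (b - m) + m)"
    and ge: "\<And>L p q. (\<And>d. 1 \<le> d \<Longrightarrow> d \<le> 2 * n \<Longrightarrow> coprime p d) \<Longrightarrow> 0 < p \<Longrightarrow> L * V \<le> p \<Longrightarrow>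
      p ^ card (comps n t) \<le> q \<Longrightarrow>
      L * N * p ^ (t * card (comps n t) - 1) \<le> max_frameproof q c s n"
    using max_frameproof_ge_levels[of t l n s c K] assms(3-8) K(2) unfolding b_def m_def by metis
  have "real N / real V = real b / ((real b - real m) + real m / real K)"
  proof -
    have "real (b * K * V) = real (N * (K * (b - m) + m))" using NV(2) by simp
    then have "real b * real K * real V = real N * (real K * (real b - real m) + real m)"
      using \<open>m < b\<close> by (simp add: of_nat_diff)
    moreover have "0 < real K * (real b - real m) + real m"
      using \<open>m < b\<close> K(2) by (intro add_pos_nonneg mult_pos_pos) auto
    ultimately show ?thesis
      using NV(1) K(2) by (simp add: field_simps)
  qed
  then have r': "r < real N / real V" using K(1) by simp
  obtain T where T: "T \<in> tsets n t"
    using \<open>m < b\<close> card_tsets[of n t] by (metis b_def card.empty ex_in_conv not_less_zero)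
  then have "(T, {}) \<in> comps n t" by (simp add: comps_def)
  then have "1 \<le> card (comps n t)"
    by (metis One_nat_def Suc_leI card_gt_0_iff empty_iff finite_comps)
  \<comment> \<open>The modulus is 1 modulo every \<open>d \<le> 2 * n\<close>, and such moduli have
    constant gaps.\<close>
  have cop: "coprime (fact (2 * n) * k + 1) d" if "1 \<le> d" "d \<le> 2 * n" for k d :: nat
  proof -
    have "d dvd fact (2 * n) * k" using that by (simp add: dvd_fact)
    then show ?thesis
      by (metis add.commute coprime_1_left coprime_commute coprime_iff_gcd_eq_1 dvd_def gcd_add_mult mult.commute)
  qed
  show ?thesis
  proof (rule eventually_ratio_gt[of "fact (2 * n)" "card (comps n t)" t V N])
    fix L k q :: nat
    assume "L * V \<le> fact (2 * n) * k + 1" "(fact (2 * n) * k + 1) ^ card (comps n t) \<le> q"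
    then show "L * N * (fact (2 * n) * k + 1) ^ (t * card (comps n t) - 1) \<le> max_frameproof q c s n"
      by (intro ge cop) simp_all
  qed (use NV(1) \<open>1 \<le> t\<close> \<open>1 \<le> card (comps n t)\<close> r' in auto)
qed

theorem theorem3p2:
  fixes n c s t l :: nat
  assumes "n \<ge> 2" and "c \<ge> 2" and "1 \<le> s" and "s \<le> c - 1"
    and "t = nat \<lceil>real (s * n) / real c\<rceil>"
    and "l \<in> {1..c}" and "[l = s * n] (mod c)"
  shows "\<exists>e :: nat \<Rightarrow> real. e \<longlonglongrightarrow> 0 \<and>
    (\<forall>q\<ge>1. real (max_frameproof q c s n) \<ge>
       (1 - e q) *
       (real (n choose t) /
         (real (n choose t) - real (max_disjoint_seq_free n t l (s + 1) (c - s + 1)))) *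
       real q ^ t)"
proof -
  define b where "b = n choose t"
  define m where "m = max_disjoint_seq_free n t l (s + 1) (c - s + 1)"
  have "1 \<le> s * n" using assms(1,3) by simp
  then have eq: "c * t + l = s * n + c"
    using assms by (intro nat_ceiling_divide_eq) auto
  have "1 \<le> t"
  proof (rule ccontr)
    assume "\<not> ?thesis"
    then have "l = s * n + c" using eq by (simp add: not_le)
    then show False using assms(6) \<open>1 \<le> s * n\<close> by simp
  qed
  have "1 \<le> l" using assms(6) by simp
  then obtain F where "F \<in> extremal n t l (s + 1) (c - s + 1)"
    using extremal_nonempty by blast
  then have "m \<le> b"
    using card_mono[OF finite_tsets, of F n t] by (auto simp: extremal_def m_def b_def card_tsets)
  show ?thesis
  proof (cases "m = b")
    \<comment> \<open>The denominator is 0 here, so the quotient is 0 by convention and the bound is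
      trivial.\<close>
    case True
    then show ?thesis by (intro exI[of _ "\<lambda>_. 0"]) (simp add: b_def m_def)
  next
    case False
    with \<open>m \<le> b\<close> have "m < b" by simp
    define \<rho> where "\<rho> = real b / (real b - real m)"
    have "0 < \<rho>" using \<open>m < b\<close> by (simp add: \<rho>_def)
    define g where "g q = real (max_frameproof q c s n) / real q ^ t" for q
    \<comment> \<open>The least nonnegative error for which the bound holds. Truncation at 0 is
      essential, since \<open>g\<close> is bounded only from below and might exceed
      \<open>\<rho>\<close>.\<close>
    define e where "e q = max 0 (1 - g q / \<rho>)" for q
    have "e \<longlonglongrightarrow> 0"
    proof (rule order_tendstoI)
      fix x :: real assume "0 < x"
      then have "(1 - x) * \<rho> < \<rho>" using \<open>0 < \<rho>\<close> by simp
      then have "eventually (\<lambda>q. (1 - x) * \<rho> < g q) sequentially"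
        using \<open>1 \<le> t\<close> \<open>1 \<le> l\<close> \<open>m < b\<close> eq assms(4,6)
        unfolding \<rho>_def g_def b_def m_def by (intro eventually_max_frameproof_gt[of t l n s c]) auto
      then show "eventually (\<lambda>q. e q < x) sequentially"
      proof eventually_elim
        case (elim q)
        then have "1 - x < g q / \<rho>" using \<open>0 < \<rho>\<close> by (simp add: field_simps)
        then show ?case using \<open>0 < x\<close> by (simp add: e_def)
      qed
    next
      fix x :: real assume "x < 0"
      then show "eventually (\<lambda>q. x < e q) sequentially" by (simp add: e_def less_max_iff_disj)
    qed
    moreover have "(1 - e q) * \<rho> * real q ^ t \<le> real (max_frameproof q c s n)" if "1 \<le> q" for q
    proof -
      have "1 - e q \<le> g q / \<rho>" by (simp add: e_def)
      then have "(1 - e q) * \<rho> \<le> g q" using \<open>0 < \<rho>\<close> by (simp add: field_simps)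
      then show ?thesis using that by (simp add: g_def field_simps)
    qed
    ultimately show ?thesis unfolding \<rho>_def b_def m_def by blast
  qed
qed

end
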